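(* Let $S=\{a^{(1)},\dots,a^{(m)}\}\subset\mathbb Z_{+}^2$ be a finite set of $m$ distinct pairs $a^{(i)}=(a^{(i)}_1,a^{(i)}_2)$ of positive integers, indexed so that the first coordinates $a_1^{(i)}$ are non-decreasing in $i$ and ties are broken by decreasing second coordinate (that is, $i<j$ implies $a^{(i)}_1<a^{(j)}_1$, or $a^{(i)}_1=a^{(j)}_1$ and $a^{(i)}_2>a^{(j)}_2$). Put $x_i=a^{(i)}_2$ for $i=1,\dots,m$. Then the smallest integer $k$ for which there is a partition $\{S_1,\dots,S_k\}$ of $S$ such that $$(a_1-b_1)(a_2-b_2)>0\quad\text{for all distinct } a=(a_1,a_2),\ b=(b_1,b_2)\in S_j,\ j=1,\dots,k,$$ is equal to the minimum number of strictly increasing subsequences into which the sequence $(x_1,\dots,x_m)$ can be partitioned.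
   Context: A partition of the sequence $(x_1,\dots,x_m)$ into strictly increasing subsequences is a partition of the index set $\{1,\dots,m\}$ into nonempty subsets such that, for any two indices $i<j$ in the same subset, $x_i<x_j$. (A pair $(a_1,a_2)$ models a controlled-Z gate between qubit $a_1$ of one row and qubit $a_2$ of another row; a set of such gates can be executed in a single transport operation exactly when the displayed non-crossing condition holds pairwise, so $k$ is the minimum number of transport operations.) *)

theory Defs
  imports Main "HOL-Library.Disjoint_Sets"
begin

definition non_crossing :: "(int \<times> int) set \<Rightarrow> bool" where
  "non_crossing T \<longleftrightarrow>
    (\<forall>a\<in>T. \<forall>b\<in>T. a \<noteq> b \<longrightarrow> (fst a - fst b) * (snd a - snd b) > 0)"

definition transport_partition :: "(int \<times> int) set \<Rightarrow> (int \<times> int) set set \<Rightarrow> bool" where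
  "transport_partition S P \<longleftrightarrow> partition_on S P \<and> (\<forall>T\<in>P. non_crossing T)"

definition min_transports :: "(int \<times> int) set \<Rightarrow> nat" where
  "min_transports S = (LEAST k. \<exists>P. transport_partition S P \<and> card P = k)"

text \<open>The sequence \<open>(x 1, ..., x m)\<close> is the restriction of \<open>x\<close> to \<open>{1..m}\<close>;
  a partition into subsequences is a partition of the index set.\<close>

definition increasing_partition :: "nat \<Rightarrow> (nat \<Rightarrow> int) \<Rightarrow> nat set set \<Rightarrow> bool" where
  "increasing_partition m x P \<longleftrightarrow> partition_on {1..m} P \<and> (\<forall>I\<in>P. strict_mono_on I x)"

definition min_increasing_subsequences :: "nat \<Rightarrow> (nat \<Rightarrow> int) \<Rightarrow> nat" where
  "min_increasing_subsequences m x = (LEAST k. \<exists>P. increasing_partition m x P \<and> card P = k)"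

text \<open>Both minima range over nonempty sets: the partition into singletons is always admissible.\<close>

lemma transport_partition_singletons: "transport_partition S ((\<lambda>a. {a}) ` S)"
  by (auto simp: transport_partition_def non_crossing_def partition_on_def disjoint_def)

lemma increasing_partition_singletons: "increasing_partition m x ((\<lambda>i. {i}) ` {1..m})"
  by (auto simp: increasing_partition_def partition_on_def disjoint_def strict_mono_on_def)

end

theory Submission
  imports Defs
begin

text \<open>Among indices \<open>i < j\<close>, the tie-breaking rule makes \<open>a i\<close> and \<open>a j\<close> non-crossing exactly
  when \<open>x i < x j\<close>: for equal first coordinates both sides fail. So \<open>a\<close> carries partitions
  of one kind to partitions of the other kind with equally many blocks.\<close>

lemma non_crossing_image_iff_strict_mono_on:
  fixes a :: "nat \<Rightarrow> int \<times> int" and x :: "nat \<Rightarrow> int"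
  assumes ord: "\<And>i j. i \<in> I \<Longrightarrow> j \<in> I \<Longrightarrow> i < j \<Longrightarrow>
           fst (a i) < fst (a j) \<or> (fst (a i) = fst (a j) \<and> snd (a i) > snd (a j))"
    and x: "\<And>i. i \<in> I \<Longrightarrow> x i = snd (a i)"
  shows "non_crossing (a ` I) \<longleftrightarrow> strict_mono_on I x"
proof
  assume nc: "non_crossing (a ` I)"
  show "strict_mono_on I x"
  proof (rule strict_mono_onI)
    fix i j assume ij: "i \<in> I" "j \<in> I" "i < j"
    from ord[OF ij] have "a i \<noteq> a j" by auto
    with nc ij have "(fst (a i) - fst (a j)) * (snd (a i) - snd (a j)) > 0"
      unfolding non_crossing_def by blast
    \<comment> \<open>A tie in the first coordinate would make the product 0. Hence the first factor
      is negative, and positivity forces the second to be negative too.\<close>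
    with ord[OF ij] x ij show "x i < x j"
      by (auto simp: zero_less_mult_iff)
  qed
next
  assume sm: "strict_mono_on I x"
  have *: "(fst (a i) - fst (a j)) * (snd (a i) - snd (a j)) > 0"
    if ij: "i \<in> I" "j \<in> I" "i < j" for i j
  proof -
    from sm ij have "x i < x j" by (auto dest: strict_mono_onD)
    \<comment> \<open>\<open>x i < x j\<close> excludes the tie alternative of \<open>ord\<close>,
      so both factors are negative.\<close>
    with ord[OF ij] x ij show ?thesis by (auto intro: mult_neg_neg)
  qed
  have "(fst (a i) - fst (a j)) * (snd (a i) - snd (a j)) > 0"
    if "i \<in> I" "j \<in> I" "a i \<noteq> a j" for i j
  proof (cases i j rule: linorder_cases)
    case greater
    \<comment> \<open>Swapping \<open>i\<close> and \<open>j\<close> flips the sign of both factors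
      and leaves the product unchanged.\<close>
    with *[of j i] that show ?thesis by (auto simp: zero_less_mult_iff)
  qed (use * that in auto)
  then show "non_crossing (a ` I)" by (auto simp: non_crossing_def)
qed

text \<open>Serves both directions of the correspondence. Blocks lie inside \<open>A\<close>, where
  \<open>f\<close> is injective, so disjoint blocks stay disjoint and distinct blocks keep distinct
  images.\<close>

lemma partition_on_image_same_card:
  assumes "partition_on A P" "inj_on f A"
  shows "partition_on (f ` A) ((`) f ` P)" "card ((`) f ` P) = card P"
proof -
  have sub: "\<Union>P = A" using assms(1) by (simp add: partition_on_def)
  \<comment> \<open>\<open>partition_on_inj_image\<close> yields the image family with
    \<open>{}\<close> removed; this shows that the removal changes nothing.\<close>
  have "{} \<notin> (`) f ` P" using partition_onD3[OF assms(1)] by auto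
  then show "partition_on (f ` A) ((`) f ` P)"
    using partition_on_inj_image[OF assms] by simp
  have "inj_on ((`) f) P"
    using inj_on_image[of f P] assms(2) sub by simp
  then show "card ((`) f ` P) = card P" by (rule card_image)
qed

theorem mainTheorem4:
  fixes S :: "(int \<times> int) set" and m :: nat
    and a :: "nat \<Rightarrow> int \<times> int" and x :: "nat \<Rightarrow> int"
  assumes "S = a ` {1..m}"
    and "inj_on a {1..m}"
    and "\<And>i. i \<in> {1..m} \<Longrightarrow> fst (a i) > 0 \<and> snd (a i) > 0"
    and "\<And>i j. i \<in> {1..m} \<Longrightarrow> j \<in> {1..m} \<Longrightarrow> i < j \<Longrightarrow>
           fst (a i) < fst (a j) \<or> (fst (a i) = fst (a j) \<and> snd (a i) > snd (a j))"
    and "\<And>i. i \<in> {1..m} \<Longrightarrow> x i = snd (a i)"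
  shows "min_transports S = min_increasing_subsequences m x"
proof -
  have block: "non_crossing (a ` I) \<longleftrightarrow> strict_mono_on I x" if "I \<subseteq> {1..m}" for I
    using that assms(4,5) by (intro non_crossing_image_iff_strict_mono_on) blast+
  \<comment> \<open>The inverse of the enumeration \<open>a\<close>, sending each pair in
    \<open>S\<close> back to its index.\<close>
  define b where "b = inv_into {1..m} a"
  have inj_b: "inj_on b S" and b_S: "b ` S = {1..m}"
    using assms(1,2) by (auto simp: b_def inj_on_inv_into)
  \<comment> \<open>Equal sets of attainable block counts make the two \<open>LEAST\<close>
    predicates coincide.\<close>
  have "(\<exists>P. transport_partition S P \<and> card P = k)
      \<longleftrightarrow> (\<exists>Q. increasing_partition m x Q \<and> card Q = k)" for k
  proof
    assume "\<exists>P. transport_partition S P \<and> card P = k"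
    then obtain P where P: "partition_on S P" "\<forall>T\<in>P. non_crossing T" "card P = k"
      by (auto simp: transport_partition_def)
    have "strict_mono_on (b ` T) x" if "T \<in> P" for T
    proof -
      have "T \<subseteq> S" using P(1) that by (auto simp: partition_on_def)
      then have "a ` b ` T = T" "b ` T \<subseteq> {1..m}"
        using b_S by (auto simp: assms(1) b_def image_inv_into_cancel)
      with block[of "b ` T"] P(2) that show ?thesis by simp
    qed
    with partition_on_image_same_card[OF P(1) inj_b] P(3) b_S
    have "increasing_partition m x ((`) b ` P) \<and> card ((`) b ` P) = k"
      by (simp add: increasing_partition_def)
    then show "\<exists>Q. increasing_partition m x Q \<and> card Q = k" by blast
  next
    assume "\<exists>Q. increasing_partition m x Q \<and> card Q = k"
    then obtain Q where Q: "partition_on {1..m} Q" "\<forall>I\<in>Q. strict_mono_on I x" "card Q = k"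
      by (auto simp: increasing_partition_def)
    have "non_crossing (a ` I)" if "I \<in> Q" for I
      using block[of I] Q that by (auto simp: partition_on_def)
    with partition_on_image_same_card[OF Q(1) assms(2)] Q(3)
    have "transport_partition S ((`) a ` Q) \<and> card ((`) a ` Q) = k"
      by (simp add: transport_partition_def assms(1))
    then show "\<exists>P. transport_partition S P \<and> card P = k" by blast
  qed
  then show ?thesis
    by (simp add: min_transports_def min_increasing_subsequences_def)
qed

end
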